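(* Let $q>2$ be an even prime power, and let $\mathcal F$ be a 2-intersecting family in an ovoidal Laguerre plane of order $q$. Then $|\mathcal F| \leq q$, and this bound is tight (i.e. such a plane has a 2-intersecting family consisting of exactly $q$ circles).
   Context: $\mathrm{PG}(n,q)$ is the projective space of (projective) dimension $n$ over $\mathbb F_q$. An oval in a projective plane $\mathrm{PG}(2,q)$ is a set of $q+1$ points, no three collinear. An oval cone in $\mathrm{PG}(3,q)$ is a set $\mathcal Q = \bigcup_{P \in \mathcal O} \langle R,P \rangle$, where $\mathcal O$ is an oval in some plane $\pi$ of $\mathrm{PG}(3,q)$, $R$ is a point not in $\pi$ (the vertex), and $\langle R,P\rangle$ is the line through $R$ and $P$. The planes of $\mathrm{PG}(3,q)$ meeting $\mathcal Q$ in an oval (the oval planes) are exactly the planes not containing $R$. An ovoidal Laguerre plane of order $q$ is an incidence structure (isomorphic to one) $(\mathcal P,\mathcal B)$ obtained from an oval cone $\mathcal Q$ in $\mathrm{PG}(3,q)$ as follows: $\mathcal P = \mathcal Q \setminus \{R\}$, and the elements of $\mathcal B$, called circles, are the sets $\pi \cap \mathcal Q$ with $\pi$ a plane of $\mathrm{PG}(3,q)$ not containing $R$. A 2-intersecting family is a set $\mathcal F \subseteq \mathcal B$ of circles any two of which have at least two points in common. *)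

theory Defs
  imports "HOL-Analysis.Cartesian_Space" "HOL-Number_Theory.Prime_Powers"
begin

text \<open>
  The projective space of dimension \<open>CARD('n) - 1\<close> over the field \<open>'k\<close>: its points are the
  one-dimensional subspaces of \<open>'k ^ 'n\<close>, and a flat is the set of all points contained in some
  vector subspace. In particular \<open>PG(3,q)\<close> is obtained from \<open>'k ^ 4\<close> with \<open>CARD('k) = q\<close>.
\<close>

definition proj_points :: "('k::field ^ 'n) set set" where
  "proj_points = {p. vec.subspace p \<and> vec.dim p = 1}"

definition points_in :: "('k::field ^ 'n) set \<Rightarrow> ('k ^ 'n) set set" where
  "points_in U = {p \<in> proj_points. p \<subseteq> U}"

definition proj_flats :: "nat \<Rightarrow> ('k::field ^ 'n) set set set" where
  "proj_flats d = {points_in U | U. vec.subspace U \<and> vec.dim U = d + 1}"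

abbreviation proj_lines :: "('k::field ^ 'n) set set set" where
  "proj_lines \<equiv> proj_flats 1"

abbreviation proj_planes :: "('k::field ^ 'n) set set set" where
  "proj_planes \<equiv> proj_flats 2"

definition proj_join :: "('k::field ^ 'n) set \<Rightarrow> ('k ^ 'n) set \<Rightarrow> ('k ^ 'n) set set" where
  "proj_join p r = points_in (vec.span (p \<union> r))"

definition proj_collinear :: "('k::field ^ 'n) set set \<Rightarrow> bool" where
  "proj_collinear S \<longleftrightarrow> (\<exists>l \<in> proj_lines. S \<subseteq> l)"

definition oval_in :: "('k::{field,finite} ^ 'n) set set \<Rightarrow> ('k ^ 'n) set set \<Rightarrow> bool" where
  "oval_in \<pi> Ov \<longleftrightarrow> \<pi> \<in> proj_planes \<and> Ov \<subseteq> \<pi> \<and> card Ov = CARD('k) + 1 \<and>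
     (\<forall>a \<in> Ov. \<forall>b \<in> Ov. \<forall>c \<in> Ov. a \<noteq> b \<and> a \<noteq> c \<and> b \<noteq> c \<longrightarrow> \<not> proj_collinear {a, b, c})"

definition oval_cone :: "('k::{field,finite} ^ 4) set \<Rightarrow> ('k ^ 4) set set \<Rightarrow> bool" where
  "oval_cone R Q \<longleftrightarrow> (\<exists>\<pi> Ov. oval_in \<pi> Ov \<and> R \<in> proj_points \<and> R \<notin> \<pi> \<and>
     Q = (\<Union>p \<in> Ov. proj_join R p))"

definition cone_circles ::
    "('k::{field,finite} ^ 4) set \<Rightarrow> ('k ^ 4) set set \<Rightarrow> ('k ^ 4) set set set" where
  "cone_circles R Q = {\<pi> \<inter> Q | \<pi>. \<pi> \<in> proj_planes \<and> R \<notin> \<pi>}"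

text \<open>
  An incidence structure is given by a point set \<open>P\<close> and a set \<open>B\<close> of subsets of \<open>P\<close>; an
  isomorphism is a bijection between the point sets that maps one set of blocks onto the other.
  The first argument fixes the field, so the order of the plane is \<open>CARD('k)\<close>.
\<close>

definition incidence_iso ::
    "('a \<Rightarrow> 'b) \<Rightarrow> 'a set \<Rightarrow> 'a set set \<Rightarrow> 'b set \<Rightarrow> 'b set set \<Rightarrow> bool" where
  "incidence_iso f P B P' B' \<longleftrightarrow> bij_betw f P P' \<and> (\<lambda>C. f ` C) ` B = B'"

definition ovoidal_Laguerre_plane ::
    "'k::{field,finite} itself \<Rightarrow> 'p set \<Rightarrow> 'p set set \<Rightarrow> bool" where
  "ovoidal_Laguerre_plane _ P B \<longleftrightarrow> B \<subseteq> Pow P \<and>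
     (\<exists>(R :: ('k ^ 4) set) Q f. oval_cone R Q \<and> incidence_iso f P B (Q - {R}) (cone_circles R Q))"

definition two_intersecting_family :: "'p set set \<Rightarrow> 'p set set \<Rightarrow> bool" where
  "two_intersecting_family B F \<longleftrightarrow> F \<subseteq> B \<and>
     (\<forall>C \<in> F. \<forall>D \<in> F. C \<noteq> D \<longrightarrow> (\<exists>x y. x \<noteq> y \<and> {x, y} \<subseteq> C \<inter> D))"

end

theory Submission imports Defs begin

text \<open>
  Project the cone from its vertex \<open>R = \<langle>r\<rangle>\<close> onto the plane \<open>U\<close> of the oval. A plane missing \<open>R\<close> is
  then the graph of a linear functional on \<open>U\<close>, and its circle is the restriction of that functional
  to the oval. Two circles with two points in common correspond to functionals whose
  difference vanishes on a secant of the oval (and, if the circles differ, nowhere else on \<open>U\<close>).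

  For even \<open>q\<close> the oval has a nucleus: there is a point \<open>N\<close> of \<open>U\<close> on no secant
  (\<open>oval_has_nucleus\<close>). Hence in a 2-intersecting family different functionals take different values
  at \<open>N\<close>, and there are only \<open>q\<close> values. The bound is attained by the multiples of a
  functional that defines a secant: their circles all pass through the two oval points on that secant.

  The nucleus comes from counting. Since the oval has an odd number of points, every point of \<open>U\<close> off
  the oval is on a tangent. A secant has \<open>q - 1\<close> points off the oval, and each of them is on one
  of the \<open>q - 1\<close> tangents at the other oval points; hence each is on exactly one tangent
  (\<open>at_most_one_tangent_on_secant\<close>). If all points were on secants, then no two tangents could meet
  off the oval, but \<open>q + 1\<close> such tangents have too many points for the plane.

  In the formal proof, points are represented by vectors, the graph of a functional is a
  three-dimensional subspace \<open>Y\<close> with \<open>r \<notin> Y\<close>, and its value at \<open>N\<close>, up to sign, is the scalar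
  \<open>t\<close> with \<open>N - t r \<in> Y\<close>.
\<close>

section \<open>Small subspaces over a finite field\<close>

lemma card_span_insert:
  fixes a :: "'k::{field,finite} ^ 'n"
  assumes "a \<notin> vec.span S"
  shows "card (vec.span (insert a S)) = CARD('k) * card (vec.span S)"
proof -
  let ?f = "\<lambda>(c, x). c *s a + x"
  have "inj_on ?f (UNIV \<times> vec.span S)"
  proof (rule inj_onI, clarsimp)
    fix c x d y
    assume x: "x \<in> vec.span S" and y: "y \<in> vec.span S" and eq: "c *s a + x = d *s a + y"
    have "(c - d) *s a = y - x"
      using eq by (simp add: vec.scale_left_diff_distrib algebra_simps)
    then have "(c - d) *s a \<in> vec.span S"
      using x y by (simp add: vec.span_diff)
    then have "c = d"
      using assms vec.span_scale[of "(c - d) *s a" S "inverse (c - d)"] by (cases "c = d") auto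
    then show "c = d \<and> x = y" using eq by simp
  qed
  moreover have "?f ` (UNIV \<times> vec.span S) = vec.span (insert a S)"
  proof (intro set_eqI iffI)
    fix z assume "z \<in> vec.span (insert a S)"
    then obtain k where "z - k *s a \<in> vec.span S" by (auto simp: vec.span_breakdown_eq)
    then have "(k, z - k *s a) \<in> UNIV \<times> vec.span S" by simp
    then show "z \<in> ?f ` (UNIV \<times> vec.span S)" by (rule rev_image_eqI) simp
  next
    fix z assume "z \<in> ?f ` (UNIV \<times> vec.span S)"
    then obtain c x where "z = c *s a + x" "x \<in> vec.span S" by auto
    then have "z - c *s a \<in> vec.span S" by simp
    then show "z \<in> vec.span (insert a S)" using vec.span_breakdown_eq by blast
  qed
  ultimately show ?thesis
    using card_image[of ?f "UNIV \<times> vec.span S"] by (simp add: card_cartesian_product)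
qed

lemma card_span_1:
  fixes a :: "'k::{field,finite} ^ 'n"
  assumes "a \<noteq> 0"
  shows "card (vec.span {a}) = CARD('k)"
  using card_span_insert[of a "{}"] assms by simp

lemma card_span_2:
  fixes a :: "'k::{field,finite} ^ 'n"
  assumes "a \<noteq> 0" "b \<notin> vec.span {a}"
  shows "card (vec.span {a, b}) = CARD('k) ^ 2"
  using card_span_insert[of b "{a}"] card_span_1[of a] assms
  by (simp add: insert_commute power2_eq_square)

lemma dim_span_2:
  fixes a :: "'k::field ^ 'n"
  assumes "a \<noteq> 0" "b \<notin> vec.span {a}"
  shows "vec.dim (vec.span {a, b}) = 2"
  using assms by (simp add: insert_commute[of a] vec.dim_insert)

lemma dim_span_3:
  fixes a :: "'k::field ^ 'n"
  assumes "a \<noteq> 0" "b \<notin> vec.span {a}" "c \<notin> vec.span {a, b}"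
  shows "vec.dim (vec.span {a, b, c}) = 3"
proof -
  have "{a, b, c} = insert c {a, b}" "{a, b} = insert b {a}" by auto
  then show ?thesis using assms by (simp add: vec.dim_insert)
qed

lemma subspace_eq_span_3:
  fixes a :: "'k::field ^ 'n"
  assumes "a \<noteq> 0" "b \<notin> vec.span {a}" "c \<notin> vec.span {a, b}"
    and "vec.subspace X" "vec.dim X = 3" "{a, b, c} \<subseteq> X"
  shows "X = vec.span {a, b, c}"
  using vec.subspace_dim_equal[of "vec.span {a, b, c}" X] vec.span_minimal[of "{a, b, c}" X]
    dim_span_3[of a b c] assms by auto

section \<open>The nucleus of an oval\<close>

lemma even_card_if_fixpoint_free_involution:
  assumes "finite A" "\<And>x. x \<in> A \<Longrightarrow> s x \<in> A \<and> s x \<noteq> x \<and> s (s x) = x"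
  shows "even (card A)"
proof -
  have "2 dvd card (\<Union>x\<in>A. {x, s x})"
  proof (rule dvd_partition)
    show "finite (\<Union>x\<in>A. {x, s x})" using assms(1) by auto
    show "\<forall>c\<in>(\<lambda>x. {x, s x}) ` A. 2 dvd card c"
    proof clarify
      fix x assume "x \<in> A"
      then have "card {x, s x} = 2" using assms(2)[of x] by (metis card_2_iff)
      then show "2 dvd card {x, s x}" by simp
    qed
    show "\<forall>c1\<in>(\<lambda>x. {x, s x}) ` A. \<forall>c2\<in>(\<lambda>x. {x, s x}) ` A. c1 \<noteq> c2 \<longrightarrow> c1 \<inter> c2 = {}"
    proof clarify
      fix x y assume "x \<in> A" "y \<in> A" and ne: "{x, s x} \<noteq> {y, s y}"
      then have "s (s x) = x" "s (s y) = y" by (simp_all only: assms(2))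
      have "{z, s z} = {w, s w}" if "z \<in> {w, s w}" "s (s w) = w" for z w
        using that by auto
      then show "{x, s x} \<inter> {y, s y} = {}"
        using ne \<open>s (s x) = x\<close> \<open>s (s y) = y\<close> by blast
    qed
  qed
  moreover have "(\<Union>x\<in>A. {x, s x}) = A" using assms(2) by auto
  ultimately show ?thesis by simp
qed

text \<open>
  Working with one representative vector per point turns every incidence into membership in a span.
  The condition on pairs says that different members represent different points, the condition on
  triples that no three of these points are collinear.
\<close>

definition arc_vectors :: "('k::field ^ 'n) set \<Rightarrow> bool" where
  "arc_vectors A \<longleftrightarrow> 0 \<notin> A \<and> (\<forall>a\<in>A. \<forall>b\<in>A. a \<noteq> b \<longrightarrow> b \<notin> vec.span {a}) \<and>
     (\<forall>a\<in>A. \<forall>b\<in>A. \<forall>c\<in>A. a \<noteq> b \<and> a \<noteq> c \<and> b \<noteq> c \<longrightarrow> c \<notin> vec.span {a, b})"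

lemma arc_vectorsD:
  assumes "arc_vectors A" "a \<in> A"
  shows "a \<noteq> 0"
    and "b \<in> A \<Longrightarrow> a \<noteq> b \<Longrightarrow> b \<notin> vec.span {a}"
    and "b \<in> A \<Longrightarrow> c \<in> A \<Longrightarrow> a \<noteq> b \<Longrightarrow> a \<noteq> c \<Longrightarrow> b \<noteq> c \<Longrightarrow> c \<notin> vec.span {a, b}"
  using assms unfolding arc_vectors_def by blast+

lemma card_secant:
  fixes A :: "('k::{field,finite} ^ 'n) set"
  assumes "arc_vectors A" "a \<in> A" "b \<in> A" "a \<noteq> b"
  shows "card (vec.span {a, b}) = CARD('k) ^ 2"
  using arc_vectorsD(1,2)[OF assms(1,2)] assms by (intro card_span_2) auto

text \<open>
  Otherwise \<open>x\<close> could replace \<open>b\<close> as a generator of \<open>\<langle>a, b\<rangle>\<close>, which would put \<open>b\<close> on the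
  secant through \<open>a\<close> and \<open>c\<close>.
\<close>

lemma secants_meet_in_arc_point:
  assumes "arc_vectors A" "a \<in> A" "b \<in> A" "c \<in> A" "a \<noteq> b" "a \<noteq> c" "b \<noteq> c"
    and "x \<in> vec.span {a, b}" "x \<in> vec.span {a, c}"
  shows "x \<in> vec.span {a}"
proof (rule ccontr)
  assume "x \<notin> vec.span {a}"
  then have "b \<in> vec.span (insert x {a})"
    using vec.in_span_insert[of x b "{a}"] assms(8) by (simp add: insert_commute)
  moreover have "vec.span (insert x {a}) \<subseteq> vec.span {a, c}"
    using assms(9) by (intro vec.span_minimal) (auto intro: vec.span_base)
  ultimately show False using arc_vectorsD(3)[of A a c b] assms by auto
qed

text \<open>
  For an oval \<open>A\<close> in a plane \<open>U\<close> of order \<open>q\<close>, exactly one of the \<open>q + 1\<close> lines through a point \<open>a\<close>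
  of \<open>A\<close> is a tangent, so the set below is this tangent with the point \<open>a\<close> removed. Defining it as
  a complement of secants gives cardinality bounds without constructing the tangent itself.
\<close>

definition on_tangent :: "('k::field ^ 'n) set \<Rightarrow> ('k ^ 'n) set \<Rightarrow> 'k ^ 'n \<Rightarrow> ('k ^ 'n) set" where
  "on_tangent U A a = U - (\<Union>b \<in> A - {a}. vec.span {a, b})"

lemma cube_decomposition: "q ^ 2 - q + (q + q * (q ^ 2 - q)) = (q::nat) ^ 3"
proof -
  obtain m where "q * q = q + m" using le_Suc_ex[of q "q * q"] by auto
  then have "q ^ 2 = q + m" "q ^ 3 = q * (q + m)"
    by (auto simp: power2_eq_square power3_eq_cube)
  with \<open>q * q = q + m\<close> show ?thesis by (simp add: distrib_left)
qed

text \<open>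
  The \<open>q\<close> secants through \<open>a\<close> share the \<open>q\<close> vectors of \<open>\<langle>a\<rangle>\<close> and have \<open>q\<^sup>2 - q\<close> further vectors
  each, so together they cover at most \<open>q + q (q\<^sup>2 - q)\<close> of the \<open>q\<^sup>3\<close> vectors.
\<close>

lemma card_on_tangent_ge:
  fixes A :: "('k::{field,finite} ^ 'n) set"
  assumes "arc_vectors A" "card A = CARD('k) + 1" "a \<in> A" "card U = CARD('k) ^ 3"
  shows "CARD('k) ^ 2 - CARD('k) \<le> card (on_tangent U A a)"
proof -
  let ?q = "CARD('k)" and ?L = "vec.span {a}"
  let ?W = "?L \<union> (\<Union>b \<in> A - {a}. vec.span {a, b} - ?L)"
  have "a \<noteq> 0" using assms(1,3) by (auto simp: arc_vectors_def)
  then have L: "card ?L = ?q" by (rule card_span_1)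
  have "card (vec.span {a, b} - ?L) = ?q ^ 2 - ?q" if "b \<in> A - {a}" for b
  proof -
    have "card (vec.span {a, b}) = ?q ^ 2"
      using that assms by (intro card_secant[of A]) auto
    moreover have "?L \<subseteq> vec.span {a, b}" by (intro vec.span_mono) auto
    ultimately show ?thesis using L by (simp add: card_Diff_subset)
  qed
  then have "card (\<Union>b \<in> A - {a}. vec.span {a, b} - ?L) \<le> ?q * (?q ^ 2 - ?q)"
    using card_UN_le[of "A - {a}" "\<lambda>b. vec.span {a, b} - ?L"] assms by simp
  then have W: "card ?W \<le> ?q + ?q * (?q ^ 2 - ?q)"
    using card_Un_le[of ?L "\<Union>b \<in> A - {a}. vec.span {a, b} - ?L"] L by linarith
  have "(\<Union>b \<in> A - {a}. vec.span {a, b}) \<subseteq> ?W" by auto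
  then have "U - ?W \<subseteq> on_tangent U A a" unfolding on_tangent_def by blast
  then have "card (U - ?W) \<le> card (on_tangent U A a)" by (intro card_mono) auto
  moreover have "card U - card ?W \<le> card (U - ?W)" by (rule diff_card_le_card_Diff) simp
  moreover have "?q ^ 2 - ?q + (?q + ?q * (?q ^ 2 - ?q)) = card U"
    unfolding assms(4) by (rule cube_decomposition)
  ultimately show ?thesis using W by arith
qed

text \<open>
  If \<open>x\<close> were on no tangent, the secants through \<open>x\<close> would pair off the points of the oval, whose
  number is odd. This is where the characteristic enters: an oval has \<open>q + 1\<close> points.
\<close>

lemma exists_tangent_through_point:
  fixes A :: "('k::{field,finite} ^ 'n) set"
  assumes arc: "arc_vectors A" and odd: "odd (card A)" and "x \<in> U"
    and off: "\<forall>a\<in>A. x \<notin> vec.span {a}"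
  shows "\<exists>a\<in>A. x \<in> on_tangent U A a"
proof (rule ccontr)
  assume "\<not> ?thesis"
  then have "\<forall>a\<in>A. \<exists>b. b \<in> A - {a} \<and> x \<in> vec.span {a, b}"
    using \<open>x \<in> U\<close> unfolding on_tangent_def by blast
  then obtain s where s: "\<forall>a\<in>A. s a \<in> A - {a} \<and> x \<in> vec.span {a, s a}" by metis
  have "s (s a) = a" if "a \<in> A" for a
  proof (rule ccontr)
    assume ne: "s (s a) \<noteq> a"
    have "x \<in> vec.span {s a, a}" "x \<in> vec.span {s a, s (s a)}"
      using s that by (auto simp: insert_commute)
    then have "x \<in> vec.span {s a}"
      using secants_meet_in_arc_point[OF arc, of "s a" a "s (s a)" x] s that ne
      by (metis Diff_iff insertI1)
    then show False using off s that by blast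
  qed
  then have "even (card A)"
    using s by (intro even_card_if_fixpoint_free_involution[of A s]) auto
  then show False using odd by simp
qed

lemma arc_span_eq:
  assumes "arc_vectors A" "A \<subseteq> U" "vec.subspace U" "vec.dim U = 3"
    and "a \<in> A" "b \<in> A" "c \<in> A" "a \<noteq> b" "a \<noteq> c" "b \<noteq> c"
  shows "U = vec.span {a, b, c}"
proof (rule subspace_eq_span_3)
  show "a \<noteq> 0" "b \<notin> vec.span {a}" "c \<notin> vec.span {a, b}"
    using arc_vectorsD[OF assms(1,5)] assms by auto
qed (use assms in auto)

lemma span_singleton_sym:
  assumes "x \<in> vec.span {a}" "x \<noteq> 0"
  shows "a \<in> vec.span {x}"
  using vec.in_span_insert[of x a "{}"] assms by simp

text \<open>
  A tangent at \<open>l\<close> should meet a secant avoiding \<open>l\<close> in a single point, that is, in \<open>q - 1\<close> nonzero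
  vectors. To see this from the complement: each of the \<open>q\<close> secants through \<open>l\<close> meets the line
  \<open>\<langle>a, b\<rangle>\<close> in a point, and these points differ, since two of the secants meet only in
  \<open>l\<close>. They use up \<open>q (q - 1)\<close> of the \<open>q\<^sup>2 - 1\<close> nonzero vectors of \<open>\<langle>a, b\<rangle>\<close>.
\<close>

lemma card_on_tangent_secant_le:
  fixes A :: "('k::{field,finite} ^ 'n) set"
  assumes arc: "arc_vectors A" and A: "card A = CARD('k) + 1"
    and U: "A \<subseteq> U" "vec.subspace U" "vec.dim U = 3"
    and abl: "a \<in> A" "b \<in> A" "l \<in> A" "a \<noteq> b" "l \<noteq> a" "l \<noteq> b"
  shows "card (on_tangent U A l \<inter> vec.span {a, b}) \<le> CARD('k) - 1"
proof -
  let ?q = "CARD('k)" and ?S = "vec.span {a, b}"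
  have q: "?q \<ge> 1" by (simp add: Suc_leI)
  have Ueq: "U = vec.span {l, a, b}" using arc_span_eq[OF arc U] abl by blast
  have "\<exists>z. z \<noteq> 0 \<and> z \<in> vec.span {l, d} \<and> z \<in> ?S" if d: "d \<in> A - {l}" for d
  proof -
    obtain k where k: "d - k *s l \<in> ?S"
      using d U(1) Ueq vec.span_breakdown_eq[of d l "{a, b}"] by auto
    have "d \<noteq> k *s l"
      using d arc abl(3) vec.span_scale[OF vec.span_base, of l "{l}" k]
      unfolding arc_vectors_def by auto
    moreover have "d - k *s l \<in> vec.span {l, d}"
      by (intro vec.span_diff vec.span_scale vec.span_base) auto
    ultimately show ?thesis using k by (intro exI[of _ "d - k *s l"]) auto
  qed
  then obtain z where z: "\<And>d. d \<in> A - {l} \<Longrightarrow> z d \<noteq> 0 \<and> z d \<in> vec.span {l, d} \<and> z d \<in> ?S"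
    by metis
  \<comment> \<open>The nonzero vectors of the point in which the secant through \<open>l\<close> and \<open>d\<close> meets \<open>?S\<close>.\<close>
  define Z where "Z d = vec.span {z d} - {0}" for d
  have Zs: "Z d \<subseteq> vec.span {l, d}" "Z d \<subseteq> ?S - {0}" if "d \<in> A - {l}" for d
    using z[OF that] vec.span_minimal[of "{z d}" "vec.span {l, d}"]
      vec.span_minimal[of "{z d}" ?S] unfolding Z_def by auto
  have "Z d \<inter> Z d' = {}" if "d \<in> A - {l}" "d' \<in> A - {l}" "d \<noteq> d'" for d d'
  proof (rule ccontr)
    assume "Z d \<inter> Z d' \<noteq> {}"
    then obtain w where w: "w \<in> Z d" "w \<in> Z d'" by blast
    then have "w \<in> vec.span {l, d}" "w \<in> vec.span {l, d'}" "w \<in> ?S" "w \<noteq> 0"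
      using Zs that by blast+
    then have "w \<in> vec.span {l}"
      using secants_meet_in_arc_point[OF arc, of l d d' w] that abl by auto
    then have "l \<in> vec.span {w}" using \<open>w \<noteq> 0\<close> by (rule span_singleton_sym)
    then have "l \<in> ?S" using vec.span_minimal[of "{w}" ?S] \<open>w \<in> ?S\<close> by auto
    then show False using arc_vectorsD(3)[OF arc abl(1-3) abl(4)] abl by auto
  qed
  moreover have "card (Z d) = ?q - 1" if "d \<in> A - {l}" for d
    using card_span_1[of "z d"] z[OF that] unfolding Z_def by (simp add: vec.span_zero)
  ultimately have "card (\<Union>d \<in> A - {l}. Z d) = ?q * (?q - 1)"
    using A abl by (subst card_UN_disjoint) auto
  moreover have "(on_tangent U A l \<inter> ?S) \<inter> (\<Union>d \<in> A - {l}. Z d) = {}"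
    using Zs unfolding on_tangent_def by blast
  then have "card ((on_tangent U A l \<inter> ?S) \<union> (\<Union>d \<in> A - {l}. Z d))
      = card (on_tangent U A l \<inter> ?S) + card (\<Union>d \<in> A - {l}. Z d)"
    by (intro card_Un_disjoint) auto
  moreover have "card ((on_tangent U A l \<inter> ?S) \<union> (\<Union>d \<in> A - {l}. Z d)) \<le> card (?S - {0})"
  proof (intro card_mono)
    have "0 \<notin> on_tangent U A l" using abl unfolding on_tangent_def by (auto intro: vec.span_zero)
    then show "(on_tangent U A l \<inter> ?S) \<union> (\<Union>d \<in> A - {l}. Z d) \<subseteq> ?S - {0}"
      using Zs by blast
  qed simp
  moreover have "card (?S - {0}) = ?q ^ 2 - 1"
    using card_secant[OF arc abl(1,2,4)] by (simp add: vec.span_zero)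
  moreover have "?q ^ 2 - 1 = ?q * (?q - 1) + (?q - 1)"
    using q by (cases ?q) (auto simp: power2_eq_square)
  ultimately show ?thesis by linarith
qed

lemma card_two_arc_points:
  fixes A :: "('k::{field,finite} ^ 'n) set"
  assumes "arc_vectors A" "a \<in> A" "b \<in> A" "a \<noteq> b"
  shows "card (vec.span {a} \<union> vec.span {b}) = 2 * CARD('k) - 1"
proof -
  have "vec.span {a} \<inter> vec.span {b} = {0}"
  proof (intro equalityI subsetI)
    fix x assume x: "x \<in> vec.span {a} \<inter> vec.span {b}"
    show "x \<in> {0}"
    proof (rule ccontr)
      assume "x \<notin> {0}"
      then have "b \<in> vec.span {x}" using x span_singleton_sym by blast
      then have "b \<in> vec.span {a}" using x vec.span_minimal[of "{x}" "vec.span {a}"] by auto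
      then show False using arc_vectorsD(2)[OF assms] by simp
    qed
  qed (auto intro: vec.span_zero)
  moreover have "card (vec.span {a}) = CARD('k)" "card (vec.span {b}) = CARD('k)"
    using assms by (auto intro!: card_span_1 simp: arc_vectors_def)
  ultimately show ?thesis
    using card_Un_Int[of "vec.span {a}" "vec.span {b}"] by simp
qed

text \<open>
  The secant has \<open>q - 1\<close> points off the oval, and each lies on some tangent by
  \<open>exists_tangent_through_point\<close>, necessarily at one of the \<open>q - 1\<close> oval points other than
  \<open>a\<close> and \<open>b\<close>. Each of these \<open>q - 1\<close> tangents covers only one point of the secant, so no
  point is covered twice. The proof counts vectors, \<open>q - 1\<close> for each point, and writes
  \<open>q = p + 2\<close> to stay clear of natural-number subtraction.
\<close>

lemma at_most_one_tangent_on_secant: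
  fixes A :: "('k::{field,finite} ^ 'n) set"
  assumes arc: "arc_vectors A" and A: "card A = CARD('k) + 1" and even: "even CARD('k)"
    and U: "A \<subseteq> U" "vec.subspace U" "vec.dim U = 3"
    and ab: "a \<in> A" "b \<in> A" "a \<noteq> b" and x: "x \<in> vec.span {a, b}"
    and l: "l \<in> A" "x \<in> on_tangent U A l" and m: "m \<in> A" "x \<in> on_tangent U A m"
  shows "l = m"
proof (rule ccontr)
  assume "l \<noteq> m"
  let ?q = "CARD('k)"
  define T where "T c = on_tangent U A c \<inter> vec.span {a, b}" for c
  have new: "c \<noteq> a \<and> c \<noteq> b" if "x \<in> on_tangent U A c" for c
    using that x ab unfolding on_tangent_def by (auto simp: insert_commute)
  have abl: "l \<noteq> a" "l \<noteq> b" "m \<noteq> a" "m \<noteq> b" using new l m by auto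
  obtain p where p: "?q = p + 2"
  proof -
    have "card {a, b, l} \<le> card A" using ab l A by (intro card_mono) (auto intro: card_ge_0_finite)
    then have "?q \<ge> 2" using A ab abl by simp
    then show ?thesis using that le_Suc_ex by (metis add.commute)
  qed
  define S where "S = vec.span {a, b} - (vec.span {a} \<union> vec.span {b})"
  have "card (vec.span {a, b}) = ?q ^ 2"
    by (rule card_secant[OF arc ab])
  moreover have "vec.span {a} \<union> vec.span {b} \<subseteq> vec.span {a, b}"
    by (intro Un_least vec.span_mono) auto
  ultimately have "card S = ?q ^ 2 - (2 * ?q - 1)"
    unfolding S_def using card_two_arc_points[OF arc ab] by (simp add: card_Diff_subset)
  then have cS: "card S = (p + 1) * (p + 1)"
    unfolding p by (simp add: power2_eq_square algebra_simps)
  have T: "card (T c) \<le> p + 1" if "c \<in> A" "c \<noteq> a" "c \<noteq> b" for c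
    using card_on_tangent_secant_le[OF arc A U, of a b c] that ab p unfolding T_def by simp
  \<comment> \<open>As \<open>x\<close> is covered by \<open>T m\<close>, it may be deleted from \<open>T l\<close>; one vector is then lacking to cover \<open>S\<close>.\<close>
  have "S \<subseteq> (\<Union>c \<in> A - {a, b, l}. T c) \<union> (T l - {x})"
  proof
    fix y assume "y \<in> S"
    then have y: "y \<in> vec.span {a, b}" "y \<notin> vec.span {a}" "y \<notin> vec.span {b}"
      by (simp_all add: S_def)
    have "y \<notin> vec.span {c}" if "c \<in> A" for c
    proof
      assume c: "y \<in> vec.span {c}"
      have "y \<noteq> 0" using y(2) vec.span_zero by metis
      then have "c \<in> vec.span {y}" by (rule span_singleton_sym[OF c])
      then have "c \<in> vec.span {a, b}"
        using y(1) vec.span_minimal[of "{y}" "vec.span {a, b}"] by auto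
      then have "c = a \<or> c = b" using arc_vectorsD(3)[OF arc ab(1,2) that ab(3)] by blast
      then show False using c y by blast
    qed
    moreover have "vec.span {a, b} \<subseteq> U" using ab U by (intro vec.span_minimal) auto
    then have "y \<in> U" using y(1) by blast
    moreover have "odd (card A)" using A even by simp
    ultimately obtain c where c: "c \<in> A" "y \<in> on_tangent U A c"
      using exists_tangent_through_point[OF arc, of y U] by blast
    then have "c \<noteq> a" "c \<noteq> b"
      using y(1) ab unfolding on_tangent_def by (auto simp: insert_commute)
    then show "y \<in> (\<Union>c \<in> A - {a, b, l}. T c) \<union> (T l - {x})"
      using c y(1) x m abl \<open>l \<noteq> m\<close> unfolding T_def by (cases "y = x") auto
  qed
  then have "card S \<le> card ((\<Union>c \<in> A - {a, b, l}. T c) \<union> (T l - {x}))"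
    by (intro card_mono) auto
  also have "\<dots> \<le> card (\<Union>c \<in> A - {a, b, l}. T c) + card (T l - {x})"
    by (rule card_Un_le)
  also have "card (\<Union>c \<in> A - {a, b, l}. T c) \<le> (\<Sum>c \<in> A - {a, b, l}. card (T c))"
    by (intro card_UN_le) simp
  also have "\<dots> \<le> (\<Sum>c \<in> A - {a, b, l}. p + 1)"
    using T by (intro sum_mono) auto
  also have "card (A - {a, b, l}) = p"
    using A p ab l abl by (simp add: card_Diff_subset)
  then have "(\<Sum>c \<in> A - {a, b, l}. p + 1) = p * (p + 1)" by simp
  also have "card (T l - {x}) \<le> p"
    using T[of l] l abl x by (simp add: T_def)
  finally show False using cS by simp
qed

text \<open>
  If every vector of \<open>U\<close> were on a secant, then the tangents (with their oval points removed) would be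
  pairwise disjoint by \<open>at_most_one_tangent_on_secant\<close>. There are \<open>q + 1\<close> of them, with at least
  \<open>q\<^sup>2 - q\<close> vectors each, so their union would have at least \<open>q\<^sup>3 - q\<close> vectors. But it avoids the
  \<open>2 q - 1 > q\<close> vectors that represent two oval points or vanish.
\<close>

lemma oval_has_nucleus:
  fixes A :: "('k::{field,finite} ^ 'n) set"
  assumes arc: "arc_vectors A" and A: "card A = CARD('k) + 1" and even: "even CARD('k)"
    and U: "A \<subseteq> U" "vec.subspace U" "vec.dim U = 3"
  shows "\<exists>N\<in>U. \<forall>a\<in>A. \<forall>b\<in>A. a \<noteq> b \<longrightarrow> N \<notin> vec.span {a, b}"
proof (rule ccontr)
  assume neg: "\<not> ?thesis"
  let ?q = "CARD('k)"
  have q: "?q \<ge> 2" using even by (metis One_nat_def Suc_1 Suc_leI card_gt_0_iff dvd_imp_le finite UNIV_not_empty)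
  have "3 \<le> card A" using A q by simp
  then obtain D where D: "D \<subseteq> A" "card D = 3" by (meson obtain_subset_with_card_n)
  then obtain a b c where abc: "a \<in> A" "b \<in> A" "c \<in> A" "a \<noteq> b" "a \<noteq> c" "b \<noteq> c"
    by (auto simp: card_3_iff)
  have "vec.span {c, a, b} = U" using arc_span_eq[OF arc U] abc by metis
  then have cU: "card U = ?q ^ 3"
    using card_span_insert[of c "{a, b}"] card_secant[OF arc abc(1,2,4)]
      arc_vectorsD(3)[OF arc abc] by (simp add: power3_eq_cube power2_eq_square)
  have "on_tangent U A l \<inter> on_tangent U A m = {}" if "l \<in> A" "m \<in> A" "l \<noteq> m" for l m
  proof (rule ccontr)
    assume "on_tangent U A l \<inter> on_tangent U A m \<noteq> {}"
    then obtain x where x: "x \<in> on_tangent U A l" "x \<in> on_tangent U A m" by blast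
    then have "x \<in> U" by (simp add: on_tangent_def)
    then obtain s t where "s \<in> A" "t \<in> A" "s \<noteq> t" "x \<in> vec.span {s, t}" using neg by blast
    then show False
      using at_most_one_tangent_on_secant[OF arc A even U _ _ _ _ that(1) x(1) that(2) x(2)]
        that(3) by blast
  qed
  then have "card (\<Union>l\<in>A. on_tangent U A l) = (\<Sum>l\<in>A. card (on_tangent U A l))"
    by (intro card_UN_disjoint) auto
  moreover have "(\<Sum>l\<in>A. card (on_tangent U A l)) \<ge> (\<Sum>l\<in>A. ?q ^ 2 - ?q)"
    using card_on_tangent_ge[OF arc A _ cU] by (intro sum_mono) auto
  moreover have "(\<Union>l\<in>A. on_tangent U A l) \<subseteq> U - (vec.span {a} \<union> vec.span {b})"
  proof
    fix x assume "x \<in> (\<Union>l\<in>A. on_tangent U A l)"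
    then obtain l where l: "l \<in> A" "x \<in> on_tangent U A l" by blast
    have "x \<notin> vec.span {d}" if "d \<in> A" "e \<in> A" "d \<noteq> e" for d e
    proof
      assume "x \<in> vec.span {d}"
      then have "x \<in> vec.span {d, e}" "x \<in> vec.span {l, d}"
        using vec.span_mono[of "{d}" "{d, e}"] vec.span_mono[of "{d}" "{l, d}"] by auto
      then show False using l that unfolding on_tangent_def by (cases "d = l") auto
    qed
    then show "x \<in> U - (vec.span {a} \<union> vec.span {b})"
      using abc l by (auto simp: on_tangent_def)
  qed
  then have "card (\<Union>l\<in>A. on_tangent U A l) \<le> card (U - (vec.span {a} \<union> vec.span {b}))"
    by (intro card_mono) auto
  moreover have "card (U - (vec.span {a} \<union> vec.span {b})) = ?q ^ 3 - (2 * ?q - 1)"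
  proof (subst card_Diff_subset)
    show "vec.span {a} \<union> vec.span {b} \<subseteq> U"
      using abc U by (intro Un_least vec.span_minimal) auto
  qed (use cU card_two_arc_points[OF arc abc(1,2,4)] in simp_all)
  ultimately have "(?q + 1) * (?q ^ 2 - ?q) \<le> ?q ^ 3 - (2 * ?q - 1)"
    using A by simp
  moreover obtain p where "?q = p + 2" using q le_Suc_ex by (metis add.commute)
  ultimately show False by (simp add: power2_eq_square power3_eq_cube algebra_simps)
qed

section \<open>Representative vectors for an oval cone\<close>

lemma proj_pointE:
  assumes "p \<in> proj_points"
  obtains u where "u \<noteq> 0" "p = vec.span {u}"
proof -
  have p: "vec.subspace p" "vec.dim p = 1" using assms by (auto simp: proj_points_def)
  obtain B where B: "B \<subseteq> p" "p \<subseteq> vec.span B" "card B = 1" "vec.independent B"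
    using vec.basis_exists[of p] p(2) by metis
  then obtain u where u: "B = {u}" by (auto simp: card_1_singleton_iff)
  have "u \<noteq> 0" using B(4) u by (auto simp: vec.dependent_zero)
  moreover have "vec.span B \<subseteq> p" using B(1) p(1) by (rule vec.span_minimal)
  ultimately show ?thesis using that[of u] B(2) u by auto
qed

lemma span_mem_points_in_iff:
  assumes "x \<noteq> 0" "vec.subspace Z"
  shows "vec.span {x} \<in> points_in Z \<longleftrightarrow> x \<in> Z"
proof
  assume "vec.span {x} \<in> points_in Z"
  then show "x \<in> Z" using vec.span_base[of x "{x}"] by (auto simp: points_in_def)
next
  assume "x \<in> Z"
  then have "vec.span {x} \<subseteq> Z" using assms by (intro vec.span_minimal) auto
  then show "vec.span {x} \<in> points_in Z"
    using assms(1) by (simp add: points_in_def proj_points_def vec.subspace_span)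
qed

lemma points_inE:
  assumes "p \<in> points_in Z"
  obtains x where "x \<noteq> 0" "x \<in> Z" "p = vec.span {x}"
proof -
  have "p \<in> proj_points" "p \<subseteq> Z" using assms by (auto simp: points_in_def)
  then obtain x where "x \<noteq> 0" "p = vec.span {x}" by (auto elim: proj_pointE)
  then show ?thesis using that[of x] \<open>p \<subseteq> Z\<close> vec.span_base[of x "{x}"] by auto
qed

lemma span_singleton_eq:
  assumes "x \<noteq> 0" "x \<in> vec.span {a}"
  shows "vec.span {x} = vec.span {a}"
proof
  show "vec.span {x} \<subseteq> vec.span {a}" using assms by (intro vec.span_minimal) auto
  show "vec.span {a} \<subseteq> vec.span {x}"
    using span_singleton_sym[OF assms(2,1)] by (intro vec.span_minimal) auto
qed

lemma oval_representatives:
  fixes Ov :: "('k::{field,finite} ^ 'n) set set"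
  assumes "oval_in \<pi> Ov"
  obtains U A where "vec.subspace U" "vec.dim U = 3" "\<pi> = points_in U" "A \<subseteq> U"
    "arc_vectors A" "card A = CARD('k) + 1" "Ov = (\<lambda>a. vec.span {a}) ` A"
proof -
  obtain U where U: "vec.subspace U" "vec.dim U = 3" "\<pi> = points_in U"
    using assms by (auto simp: oval_in_def proj_flats_def)
  have "\<forall>p\<in>Ov. \<exists>x. x \<noteq> 0 \<and> x \<in> U \<and> p = vec.span {x}"
    using assms U(3) by (auto simp: oval_in_def elim!: points_inE dest!: subsetD)
  then obtain u where u: "\<And>p. p \<in> Ov \<Longrightarrow> u p \<noteq> 0 \<and> u p \<in> U \<and> p = vec.span {u p}"
    by metis
  have u0: "u p \<noteq> 0" and uU: "u p \<in> U" and span_u: "vec.span {u p} = p" if "p \<in> Ov" for p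
    using u[OF that] by simp_all
  have inj: "inj_on u Ov" using span_u by (metis inj_onI)
  have pair: "u p \<notin> vec.span {u r}" if "p \<in> Ov" "r \<in> Ov" "p \<noteq> r" for p r
  proof
    assume "u p \<in> vec.span {u r}"
    then have "vec.span {u p} = vec.span {u r}"
      by (rule span_singleton_eq[OF u0[OF that(1)]])
    then show False using span_u that by simp
  qed
  have triple: "u p \<notin> vec.span {u r, u s}"
    if prs: "p \<in> Ov" "r \<in> Ov" "s \<in> Ov" "p \<noteq> r" "p \<noteq> s" "r \<noteq> s" for p r s
  proof
    assume p: "u p \<in> vec.span {u r, u s}"
    let ?l = "vec.span {u r, u s}"
    have "vec.dim ?l = 2" using u0[OF prs(2)] pair[of s r] prs by (intro dim_span_2) auto
    then have "points_in ?l \<in> proj_lines"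
      unfolding proj_flats_def using vec.subspace_span by fastforce
    moreover have "x \<in> points_in ?l" if "x \<in> Ov" "u x \<in> ?l" for x
    proof -
      have "vec.span {u x} \<in> points_in ?l"
        using u0[OF that(1)] that(2) span_mem_points_in_iff vec.subspace_span by blast
      then show ?thesis using span_u[OF that(1)] by simp
    qed
    then have "{p, r, s} \<subseteq> points_in ?l"
      using p prs by (simp add: vec.span_base)
    ultimately have "proj_collinear {p, r, s}" unfolding proj_collinear_def by blast
    then show False using assms that unfolding oval_in_def by blast
  qed
  have arc: "arc_vectors (u ` Ov)"
    unfolding arc_vectors_def
  proof (intro conjI)
    show "0 \<notin> u ` Ov" using u0 by force
    show "\<forall>a\<in>u ` Ov. \<forall>b\<in>u ` Ov. a \<noteq> b \<longrightarrow> b \<notin> vec.span {a}" using pair by blast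
    show "\<forall>a\<in>u ` Ov. \<forall>b\<in>u ` Ov. \<forall>c\<in>u ` Ov.
        a \<noteq> b \<and> a \<noteq> c \<and> b \<noteq> c \<longrightarrow> c \<notin> vec.span {a, b}" using triple by blast
  qed
  have card: "card (u ` Ov) = CARD('k) + 1"
    using assms card_image[OF inj] by (simp add: oval_in_def)
  have Ov: "Ov = (\<lambda>a. vec.span {a}) ` (u ` Ov)"
  proof -
    have "(\<lambda>p. vec.span {u p}) ` Ov = (\<lambda>p. p) ` Ov" using span_u by (intro image_cong) simp_all
    then show ?thesis by (simp add: image_image)
  qed
  have "u ` Ov \<subseteq> U" using uU by blast
  then show ?thesis by (rule that[OF U _ arc card Ov])
qed

lemma oval_cone_representatives:
  fixes R :: "('k::{field,finite} ^ 4) set"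
  assumes "oval_cone R Q"
  obtains r U A where "R = vec.span {r}" "r \<notin> U" "vec.subspace U" "vec.dim U = 3" "A \<subseteq> U"
    "arc_vectors A" "card A = CARD('k) + 1" "Q = (\<Union>a\<in>A. points_in (vec.span {r, a}))"
proof -
  obtain \<pi> Ov where oval: "oval_in \<pi> Ov" and R: "R \<in> proj_points" "R \<notin> \<pi>"
    and Q: "Q = (\<Union>p \<in> Ov. proj_join R p)" using assms unfolding oval_cone_def by blast
  obtain U A where U: "vec.subspace U" "vec.dim U = 3" "\<pi> = points_in U"
    and A: "A \<subseteq> U" "arc_vectors A" "card A = CARD('k) + 1" "Ov = (\<lambda>a. vec.span {a}) ` A"
    using oval by (rule oval_representatives)
  obtain r where r: "r \<noteq> 0" "R = vec.span {r}" using R(1) by (rule proj_pointE)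
  have "r \<notin> U" using R(2) r U span_mem_points_in_iff by blast
  moreover have "proj_join R (vec.span {a}) = points_in (vec.span {r, a})" for a
  proof -
    have "vec.span (vec.span {r} \<union> vec.span {a}) = vec.span {r, a}"
    proof
      show "vec.span (vec.span {r} \<union> vec.span {a}) \<subseteq> vec.span {r, a}"
        by (intro vec.span_minimal Un_least vec.span_mono vec.subspace_span) auto
      show "vec.span {r, a} \<subseteq> vec.span (vec.span {r} \<union> vec.span {a})"
        by (intro vec.span_mono) (auto intro: vec.span_base)
    qed
    then show ?thesis by (simp add: proj_join_def r)
  qed
  then have "Q = (\<Union>a\<in>A. points_in (vec.span {r, a}))" unfolding Q A(4) by simp
  ultimately show ?thesis using that[OF r(2) _ U(1,2) A(1-3)] by simp
qed

section \<open>Families of circles of an oval cone\<close>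

text \<open>
  In a four-dimensional space a hyperplane that does not contain \<open>r\<close> is a complement of the line
  \<open>\<langle>r\<rangle>\<close>, so every coset of that line meets it.
\<close>

lemma plane_meets_parallel_line:
  fixes Y :: "('k::field ^ 4) set"
  assumes "vec.subspace Y" "vec.dim Y = 3" "r \<notin> Y"
  shows "\<exists>k. x - k *s r \<in> Y"
proof -
  have sp: "vec.span Y = Y" using assms(1) by simp
  have "r \<notin> vec.span Y" unfolding sp by (rule assms(3))
  then have "vec.dim (insert r Y) = 4" using assms(2) by (simp add: vec.dim_insert)
  then have "vec.dim (vec.span (insert r Y)) = vec.dim (UNIV :: ('k ^ 4) set)"
    unfolding vec.dim_span vec_dim_card by simp
  then have "vec.span (insert r Y) = UNIV"
    by (intro vec.subspace_dim_equal) auto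
  then show ?thesis using vec.span_breakdown_eq[of x r Y] unfolding sp by auto
qed

lemma cone_circlesE:
  fixes R :: "('k::{field,finite} ^ 4) set"
  assumes "C \<in> cone_circles R Q" "R = vec.span {r}" "r \<noteq> 0"
  obtains Y where "vec.subspace Y" "vec.dim Y = 3" "r \<notin> Y" "C = points_in Y \<inter> Q"
proof -
  obtain Y where Y: "vec.subspace Y" "vec.dim Y = 3" "R \<notin> points_in Y" "C = points_in Y \<inter> Q"
    using assms(1) by (auto simp: cone_circles_def proj_flats_def)
  then show ?thesis using that span_mem_points_in_iff assms by metis
qed

text \<open>
  Two common points of the circles lie on different generators \<open>\<langle>r, a\<rangle>\<close> and \<open>\<langle>r, b\<rangle>\<close> of the cone,
  because a plane that misses the vertex meets each generator only once. Projected from the vertex,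
  they become \<open>a\<close> and \<open>b\<close>, while the third common vector \<open>N - t r\<close> becomes \<open>N\<close>, which is not on the
  secant through \<open>a\<close> and \<open>b\<close>. So the two planes share three independent vectors.
\<close>

lemma planes_eq_if_circles_meet_twice:
  fixes Y :: "('k::{field,finite} ^ 4) set"
  assumes U: "vec.subspace U" "r \<notin> U" "A \<subseteq> U"
    and Q: "Q = (\<Union>a\<in>A. points_in (vec.span {r, a}))"
    and N: "N \<in> U" "\<forall>a\<in>A. \<forall>b\<in>A. a \<noteq> b \<longrightarrow> N \<notin> vec.span {a, b}"
    and Y: "vec.subspace Y" "vec.dim Y = 3" "r \<notin> Y" "N - t *s r \<in> Y"
    and Z: "vec.subspace Z" "vec.dim Z = 3" "N - t *s r \<in> Z"
    and xy: "x \<noteq> y" "{x, y} \<subseteq> (points_in Y \<inter> Q) \<inter> (points_in Z \<inter> Q)"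
  shows "Y = Z"
proof -
  obtain a b where ab: "a \<in> A" "b \<in> A" "x \<in> points_in (vec.span {r, a})"
      "y \<in> points_in (vec.span {r, b})"
    using xy(2) Q by auto
  obtain u where u: "u \<noteq> 0" "u \<in> vec.span {r, a}" "x = vec.span {u}"
    using ab(3) by (rule points_inE)
  obtain v where v: "v \<noteq> 0" "v \<in> vec.span {r, b}" "y = vec.span {v}"
    using ab(4) by (rule points_inE)
  have YZ: "u \<in> Y" "v \<in> Y" "u \<in> Z" "v \<in> Z"
    using xy(2) u v Y(1) Z(1) span_mem_points_in_iff by blast+
  have uv: "v \<notin> vec.span {u}" using span_singleton_eq[OF v(1)] xy(1) u(3) v(3) by metis
  have "a \<noteq> b"
  proof
    assume "a = b"
    have "vec.dim (vec.span {r, a}) \<le> card {r, a}"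
      unfolding vec.dim_span by (intro vec.dim_le_card') simp
    also have "\<dots> \<le> 2" by (simp add: card_insert_if)
    finally have "vec.dim (vec.span {r, a}) \<le> vec.dim (vec.span {u, v})"
      using dim_span_2[OF u(1) uv] by simp
    then have "vec.span {u, v} = vec.span {r, a}"
      using u v \<open>a = b\<close> by (intro vec.subspace_dim_equal vec.span_minimal) auto
    moreover have "vec.span {u, v} \<subseteq> Y" using YZ Y by (intro vec.span_minimal) auto
    ultimately show False using Y(3) vec.span_base[of r "{r, a}"] by auto
  qed
  have "N - t *s r \<notin> vec.span {u, v}"
  proof
    assume "N - t *s r \<in> vec.span {u, v}"
    moreover have "vec.span {u, v} \<subseteq> vec.span {r, a, b}"
      using u(2) v(2) vec.span_mono[of "{r, a}" "{r, a, b}"] vec.span_mono[of "{r, b}" "{r, a, b}"]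
      by (intro vec.span_minimal) auto
    ultimately have "N - t *s r + t *s r \<in> vec.span {r, a, b}"
      by (intro vec.span_add vec.span_scale) (auto intro: vec.span_base)
    then have "N \<in> vec.span (insert r {a, b})" by simp
    moreover have "N \<notin> vec.span {a, b}" using N(2) ab \<open>a \<noteq> b\<close> by blast
    ultimately have "r \<in> vec.span (insert N {a, b})" by (rule vec.in_span_insert)
    moreover have "vec.span (insert N {a, b}) \<subseteq> U"
      using N(1) ab U by (intro vec.span_minimal) auto
    ultimately show False using U(2) by blast
  qed
  then have "Y = vec.span {u, v, N - t *s r}" "Z = vec.span {u, v, N - t *s r}"
    using subspace_eq_span_3[OF u(1) uv] Y Z YZ by auto
  then show ?thesis by simp
qed

text \<open>
  With \<open>N\<close> the nucleus, a circle is sent to the scalar \<open>t\<close> for which its plane contains \<open>N - t r\<close>. By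
  the preceding lemma, different circles of the family have different scalars.
\<close>

lemma card_two_intersecting_cone_family_le:
  fixes R :: "('k::{field,finite} ^ 4) set"
  assumes cone: "oval_cone R Q" and even: "even CARD('k)"
    and F: "two_intersecting_family (cone_circles R Q) F"
  shows "card F \<le> CARD('k)"
proof -
  obtain r U A where R: "R = vec.span {r}" "r \<notin> U" and U: "vec.subspace U" "vec.dim U = 3"
    and A: "A \<subseteq> U" "arc_vectors A" "card A = CARD('k) + 1"
    and Q: "Q = (\<Union>a\<in>A. points_in (vec.span {r, a}))"
    using cone by (rule oval_cone_representatives)
  have r: "r \<noteq> 0" using R(2) U(1) vec.subspace_0 by blast
  obtain N where N: "N \<in> U" "\<forall>a\<in>A. \<forall>b\<in>A. a \<noteq> b \<longrightarrow> N \<notin> vec.span {a, b}"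
    using oval_has_nucleus[OF A(2,3) even A(1) U] by blast
  have "\<forall>C\<in>F. \<exists>Y. vec.subspace Y \<and> vec.dim Y = 3 \<and> r \<notin> Y \<and> points_in Y \<inter> Q = C"
  proof
    fix C assume "C \<in> F"
    then have "C \<in> cone_circles R Q" using F by (auto simp: two_intersecting_family_def)
    then obtain Y where "vec.subspace Y" "vec.dim Y = 3" "r \<notin> Y" "C = points_in Y \<inter> Q"
      using R(1) r by (rule cone_circlesE)
    then show "\<exists>Y. vec.subspace Y \<and> vec.dim Y = 3 \<and> r \<notin> Y \<and> points_in Y \<inter> Q = C"
      by blast
  qed
  from bchoice[OF this] obtain Y where
    Y': "\<forall>C\<in>F. vec.subspace (Y C) \<and> vec.dim (Y C) = 3 \<and> r \<notin> Y C \<and> points_in (Y C) \<inter> Q = C" ..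
  then have Y: "vec.subspace (Y C)" "vec.dim (Y C) = 3" "r \<notin> Y C"
    and YC: "points_in (Y C) \<inter> Q = C" if "C \<in> F" for C
    using that by simp_all
  define t where "t C = (SOME k. N - k *s r \<in> Y C)" for C
  have t: "N - t C *s r \<in> Y C" if "C \<in> F" for C
    unfolding t_def by (rule someI_ex) (rule plane_meets_parallel_line[OF Y[OF that]])
  have "inj_on t F"
  proof (rule inj_onI, rule ccontr)
    fix C D assume CD: "C \<in> F" "D \<in> F" "t C = t D" "C \<noteq> D"
    have "\<exists>x y. x \<noteq> y \<and> {x, y} \<subseteq> C \<inter> D"
      using F CD(1,2,4) unfolding two_intersecting_family_def by simp
    then obtain x y where xy: "x \<noteq> y" "{x, y} \<subseteq> C \<inter> D" by (elim exE conjE)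
    have "N - t C *s r \<in> Y C" using t CD(1) by simp
    moreover have "N - t C *s r \<in> Y D" using t CD(2,3) by simp
    moreover have "{x, y} \<subseteq> (points_in (Y C) \<inter> Q) \<inter> (points_in (Y D) \<inter> Q)"
      unfolding YC[OF CD(1)] YC[OF CD(2)] by (rule xy(2))
    ultimately have "Y C = Y D"
      using planes_eq_if_circles_meet_twice[OF U(1) R(2) A(1) Q N Y[OF CD(1)] _ Y(1,2)[OF CD(2)] _ xy(1)]
      by simp
    then have "C = D" using YC[OF CD(1)] YC[OF CD(2)] by argo
    then show False using CD(4) by contradiction
  qed
  then have "card F \<le> card (UNIV :: 'k set)" by (intro card_inj_on_le) auto
  then show ?thesis .
qed

text \<open>
  Fix two points \<open>a\<close>, \<open>b\<close> of the oval and let a plane through both turn around their secant: each of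
  the \<open>q\<close> points \<open>c + t r\<close> on a third generator, other than the vertex, determines one such plane.
\<close>

lemma exists_two_intersecting_cone_family:
  fixes R :: "('k::{field,finite} ^ 4) set"
  assumes cone: "oval_cone R Q" and q: "CARD('k) \<ge> 2"
  shows "\<exists>F. two_intersecting_family (cone_circles R Q) F \<and> card F = CARD('k)"
proof -
  obtain r U A where R: "R = vec.span {r}" "r \<notin> U" and U: "vec.subspace U" "vec.dim U = 3"
    and A: "A \<subseteq> U" "arc_vectors A" "card A = CARD('k) + 1"
    and Q: "Q = (\<Union>a\<in>A. points_in (vec.span {r, a}))"
    using cone by (rule oval_cone_representatives)
  have r: "r \<noteq> 0" using R(2) U(1) vec.subspace_0 by blast
  have "3 \<le> card A" using A q by simp
  then obtain D where D: "D \<subseteq> A" "card D = 3" by (meson obtain_subset_with_card_n)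
  then obtain a b c where abc: "a \<in> A" "b \<in> A" "c \<in> A" "a \<noteq> b" "a \<noteq> c" "b \<noteq> c"
    by (auto simp: card_3_iff)
  have nz: "a \<noteq> 0" "b \<noteq> 0" using arc_vectorsD(1)[OF A(2)] abc by auto
  have ab: "b \<notin> vec.span {a}" using arc_vectorsD(2)[OF A(2) abc(1,2,4)] .
  have abU: "vec.span {a, b} \<subseteq> U" using A abc U by (intro vec.span_minimal) auto
  have mult: "r \<in> W" if "vec.subspace W" "k *s r \<in> W" "k \<noteq> 0" for W k
    using vec.subspace_scale[OF that(1,2), of "inverse k"] that(3) by simp
  define Y where "Y t = vec.span {a, b, c + t *s r}" for t
  have off: "c + t *s r \<notin> vec.span {a, b}" for t
  proof
    assume t: "c + t *s r \<in> vec.span {a, b}"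
    then have "c + t *s r - c \<in> U" using abU abc A U by (intro vec.subspace_diff) auto
    then have "t = 0" using mult[OF U(1)] R(2) by auto
    then show False using t arc_vectorsD(3)[OF A(2) abc] by simp
  qed
  have sub: "vec.subspace (Y t)" "vec.dim (Y t) = 3" for t
    unfolding Y_def using dim_span_3[OF nz(1) ab off] by auto
  have memY: "a \<in> Y t" "b \<in> Y t" "c + t *s r \<in> Y t" for t
    unfolding Y_def by (auto intro: vec.span_base)
  have rY: "r \<notin> Y t" for t
  proof
    assume "r \<in> Y t"
    then have "c + t *s r - t *s r \<in> Y t"
      using sub memY by (intro vec.subspace_diff vec.subspace_scale) auto
    then have "{a, b, c} \<subseteq> Y t" using memY by simp
    then have "Y t = vec.span {a, b, c}"
      using subspace_eq_span_3[OF nz(1) ab arc_vectorsD(3)[OF A(2) abc] sub] by blast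
    also have "\<dots> = U" using arc_span_eq[OF A(2,1) U abc] by simp
    finally show False using R(2) \<open>r \<in> Y t\<close> by blast
  qed
  define C where "C t = points_in (Y t) \<inter> Q" for t
  have inQ: "vec.span {x} \<in> Q" if "x \<noteq> 0" "d \<in> A" "x \<in> vec.span {r, d}" for x d
    using that Q span_mem_points_in_iff[of x "vec.span {r, d}"] by auto
  have "inj C"
  proof (rule injI, rule ccontr)
    fix s t assume st: "C s = C t" "s \<noteq> t"
    have "c + s *s r \<noteq> 0" using off vec.span_zero by metis
    moreover have "c + s *s r \<in> vec.span {r, c}"
      by (intro vec.span_add vec.span_scale) (auto intro: vec.span_base)
    ultimately have "vec.span {c + s *s r} \<in> C s"
      unfolding C_def using inQ abc(3) memY sub span_mem_points_in_iff by blast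
    then have "c + s *s r \<in> Y t"
      using st(1) sub span_mem_points_in_iff[OF \<open>c + s *s r \<noteq> 0\<close>] unfolding C_def by blast
    then have "(c + s *s r) - (c + t *s r) \<in> Y t"
      using memY sub by (intro vec.subspace_diff)
    then have "(s - t) *s r \<in> Y t" by (simp add: vec.scale_left_diff_distrib)
    then show False using mult[OF sub(1)] rY st(2) by (metis eq_iff_diff_eq_0)
  qed
  then have "card (range C) = CARD('k)" by (rule card_image)
  moreover have "C t \<in> cone_circles R Q" for t
  proof -
    have "points_in (Y t) \<in> proj_planes" unfolding proj_flats_def using sub by fastforce
    moreover have "R \<notin> points_in (Y t)" using R(1) span_mem_points_in_iff[OF r sub(1)] rY by blast
    ultimately show ?thesis unfolding C_def cone_circles_def by blast
  qed
  moreover have "{vec.span {a}, vec.span {b}} \<subseteq> C s \<inter> C t" for s t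
  proof -
    have "vec.span {a} \<in> Q" "vec.span {b} \<in> Q"
      using inQ nz abc by (auto intro: vec.span_base)
    then show ?thesis unfolding C_def using memY sub nz span_mem_points_in_iff by blast
  qed
  moreover have "vec.span {a} \<noteq> vec.span {b}"
    using ab vec.span_base[of b "{b}"] by auto
  ultimately have "two_intersecting_family (cone_circles R Q) (range C)"
    unfolding two_intersecting_family_def by blast
  then show ?thesis using \<open>card (range C) = CARD('k)\<close> by blast
qed

section \<open>Transfer along isomorphisms\<close>

lemma inj_on_image_blocks:
  assumes "incidence_iso f P B P' B'" "B \<subseteq> Pow P"
  shows "inj_on ((`) f) B"
proof (rule inj_onI)
  fix C D assume "C \<in> B" "D \<in> B" "f ` C = f ` D"
  moreover have "inj_on f P" using assms(1) by (simp add: incidence_iso_def bij_betw_def)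
  ultimately show "C = D" using inj_on_image_eq_iff[of f P C D] assms(2) by auto
qed

lemma two_intersecting_family_iso_iff:
  assumes iso: "incidence_iso f P B P' B'" and B: "B \<subseteq> Pow P" and F: "F \<subseteq> B"
  shows "two_intersecting_family B' ((`) f ` F) \<longleftrightarrow> two_intersecting_family B F"
proof -
  have inj: "inj_on f P" and B': "(`) f ` B = B'"
    using iso by (auto simp: incidence_iso_def bij_betw_def)
  have two: "(\<exists>x y. x \<noteq> y \<and> {x, y} \<subseteq> f ` C \<inter> f ` D) \<longleftrightarrow> (\<exists>x y. x \<noteq> y \<and> {x, y} \<subseteq> C \<inter> D)"
    if "C \<in> F" "D \<in> F" for C D
  proof -
    have "C \<subseteq> P" "D \<subseteq> P" using that F B by auto
    then have int: "f ` C \<inter> f ` D = f ` (C \<inter> D)" and "inj_on f (C \<inter> D)"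
      using inj by (auto simp: inj_on_image_Int inj_on_def)
    show ?thesis unfolding int
    proof
      assume "\<exists>x y. x \<noteq> y \<and> {x, y} \<subseteq> f ` (C \<inter> D)"
      then obtain x y where "f x \<noteq> f y" "x \<in> C \<inter> D" "y \<in> C \<inter> D" by auto
      then show "\<exists>x y. x \<noteq> y \<and> {x, y} \<subseteq> C \<inter> D" by (intro exI[of _ x] exI[of _ y]) auto
    next
      assume "\<exists>x y. x \<noteq> y \<and> {x, y} \<subseteq> C \<inter> D"
      then obtain x y where "x \<noteq> y" "x \<in> C \<inter> D" "y \<in> C \<inter> D" by blast
      then have "f x \<noteq> f y" "{f x, f y} \<subseteq> f ` (C \<inter> D)"
        using \<open>inj_on f (C \<inter> D)\<close> by (auto simp: inj_on_def)
      then show "\<exists>x y. x \<noteq> y \<and> {x, y} \<subseteq> f ` (C \<inter> D)"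
        by (intro exI[of _ "f x"] exI[of _ "f y"]) auto
    qed
  qed
  have "f ` C \<noteq> f ` D \<longleftrightarrow> C \<noteq> D" if "C \<in> F" "D \<in> F" for C D
    using inj_on_image_blocks[OF iso B] F that by (meson inj_on_eq_iff subsetD)
  moreover have "(`) f ` F \<subseteq> B'" using F B' by blast
  ultimately show ?thesis using two F by (simp add: two_intersecting_family_def)
qed

section \<open>Two-intersecting families in ovoidal Laguerre planes\<close>

theorem theorem5p14:
  fixes q :: nat and P :: "'p set" and B :: "'p set set"
  assumes "primepow q" and "even q" and "q > 2"
    and "CARD('k::{field,finite}) = q"
    and "ovoidal_Laguerre_plane TYPE('k) P B"
  shows "(\<forall>F. two_intersecting_family B F \<longrightarrow> finite F \<and> card F \<le> q) \<and>
         (\<exists>F. two_intersecting_family B F \<and> card F = q)"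
proof -
  obtain R :: "('k ^ 4) set" and Q f where B: "B \<subseteq> Pow P" and cone: "oval_cone R Q"
    and iso: "incidence_iso f P B (Q - {R}) (cone_circles R Q)"
    using assms(5) unfolding ovoidal_Laguerre_plane_def by blast
  note inj = inj_on_image_blocks[OF iso B]
  note transfer = two_intersecting_family_iso_iff[OF iso B]
  have "finite F \<and> card F \<le> q" if F: "two_intersecting_family B F" for F
  proof -
    have FB: "F \<subseteq> B" using F by (simp add: two_intersecting_family_def)
    have injF: "inj_on ((`) f) F" using inj FB by (rule inj_on_subset)
    then have "finite F" by (rule finite_imageD[rotated]) simp
    moreover have "card F = card ((`) f ` F)" using card_image[OF injF] by simp
    moreover have "card ((`) f ` F) \<le> CARD('k)"
      using F FB assms(2,4) transfer
      by (intro card_two_intersecting_cone_family_le[OF cone]) auto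
    ultimately show ?thesis using assms(4) by simp
  qed
  moreover have "\<exists>F. two_intersecting_family B F \<and> card F = q"
  proof -
    obtain G where G: "two_intersecting_family (cone_circles R Q) G" "card G = q"
      using exists_two_intersecting_cone_family[OF cone] assms(3,4) by auto
    then have "G \<subseteq> (`) f ` B"
      using iso by (simp add: two_intersecting_family_def incidence_iso_def)
    then obtain F where F: "F \<subseteq> B" "G = (`) f ` F" by (meson subset_imageE)
    then have "card F = q" using G(2) card_image[OF inj_on_subset[OF inj F(1)]] by simp
    then show ?thesis using transfer F G(1) by blast
  qed
  ultimately show ?thesis by blast
qed

end
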